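(* Let $\mathcal{G}=(I_N,\mathcal{S},(A_i)_{i\in I_N},\pi^{(N)},(V_i)_{i\in I_N})$ be a game and let $s_0\in\mathcal{S}$. Then $\mathcal{G}$ with initial state $s_0$ is a closed-loop potential game with potential function $\Phi^{s_0}:\pi^{(N)}\to\mathbb{R}$ if and only if for all $i\in I_N$ there exists a function $U_i^{s_0}:\pi^{(N)}_{-i}\to\mathbb{R}$ such that $$V_i^{s_0}((\phi_i,\phi_{-i}))=\Phi^{s_0}((\phi_i,\phi_{-i}))+U_i^{s_0}(\phi_{-i})\qquad\text{for all }\phi_i\in\pi_i,\ \phi_{-i}\in\pi^{(N)}_{-i}. \quad ( * )$$ Furthermore, $\mathcal{G}$ is a Markov potential game if and only if there exist functions $\Phi^{s_0}:\pi^{(N)}\to\mathbb{R}$, $s_0\in\mathcal{S}$, and $U_i^{s_0}:\pi^{(N)}_{-i}\to\mathbb{R}$, $s_0\in\mathcal{S}$, $i\in I_N$, such that $( * )$ holds for all $s_0\in\mathcal{S}$ and $i\in I_N$.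
   Context: A game $\mathcal{G}=(I_N,\mathcal{S},(A_i)_{i\in I_N},\pi^{(N)},(V_i)_{i\in I_N})$ consists of: a finite set of players $I_N=\{1,\dots,N\}$, $N\in\mathbb{N}$; a topological space $\mathcal{S}$ (state space); for each $i$ a Borel subset $A_i$ of a topological vector space (action set of player $i$); the set of joint policy profiles $\pi^{(N)}=\prod_{i\in I_N}\pi_i$, where $\pi_i$ is a set of Borel measurable functions $\phi_i:\mathcal{S}\to A_i$ (admissible policies of player $i$); and value functions $V_i:\mathcal{S}\times\pi^{(N)}\to\mathbb{R}$, with $V_i^{s}(\phi):=V_i(s,\phi)$. Write $\pi^{(N)}_{-i}=\prod_{j\in I_N\setminus\{i\}}\pi_j$, and $\phi=(\phi_i)_{i\in I_N}=(\phi_i,\phi_{-i})$ with $\phi_{-i}=(\phi_j)_{j\ne i}\in\pi_{-i}^{(N)}$. The game $\mathcal{G}$ with initial state $s_0\in\mathcal{S}$ is a closed-loop potential game (CLPG) if there exists $\Phi^{s_0}:\pi^{(N)}\to\mathbb{R}$, called a potential function, such that for all $i\in I_N$, $\phi_i,\phi_i'\in\pi_i$ and $\phi_{-i}\in\pi^{(N)}_{-i}$, $$\Phi^{s_0}((\phi_i',\phi_{-i}))-\Phi^{s_0}((\phi_i,\phi_{-i}))=V_i^{s_0}((\phi_i',\phi_{-i}))-V_i^{s_0}((\phi_i,\phi_{-i})).$$ The game $\mathcal{G}$ is a Markov potential game (MPG) if there exists $\Phi:\mathcal{S}\times\pi^{(N)}\to\mathbb{R}$ (a potential function) such that for all $s_0\in\mathcal{S}$,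 $\Phi(s_0,\cdot)$ is a potential function of $\mathcal{G}$ with initial state $s_0$. *)

theory Defs
  imports "HOL-Analysis.Analysis" "HOL-Algebra.Module" "HOL-Decision_Procs.Algebra_Aux"
begin

text \<open>
  Carrier-based topological vector spaces over the reals, so that each player of a game may have
  an action space of its own. The ring record of the reals is \<^term>\<open>cring_class_ops\<close>. As usual
  for the record type of modules, the ring multiplication fields of \<open>E\<close> play no role.
  The Hausdorff property is not required.
\<close>

record 'a tvs = "(real, 'a) module" +
  vtopology :: "'a topology"

locale topological_vector_space = module "cring_class_ops :: real ring" E
  for E :: "'a tvs" (structure) +
  assumes topspace_eq_carrier: "topspace (vtopology E) = carrier E"
    and continuous_add:
      "continuous_map (prod_topology (vtopology E) (vtopology E)) (vtopology E)
         (\<lambda>(x, y). x \<oplus> y)"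
    and continuous_smult:
      "continuous_map (prod_topology euclideanreal (vtopology E)) (vtopology E)
         (\<lambda>(c, x). c \<odot> x)"

definition borel_of :: "'a topology \<Rightarrow> 'a measure" where
  "borel_of T = sigma (topspace T) {U. openin T U}"

definition borel_functions :: "'s topology \<Rightarrow> 'a topology \<Rightarrow> 'a set \<Rightarrow> ('s \<Rightarrow> 'a) set" where
  "borel_functions S T A =
     (borel_of S \<rightarrow>\<^sub>M restrict_space (borel_of T) A) \<inter> extensional (topspace S)"

text \<open>
  Functions between sets are represented by total functions. Policies and policy profiles are
  taken extensional, so that they are determined by their values on their domain. The values of
  \<open>value_fun G i s \<phi>\<close> matter only for \<open>i\<close> a player, \<open>s\<close> a state and \<open>\<phi>\<close> a joint policy profile.
\<close>

record ('s, 'a) game =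
  num_players :: nat
  state_space :: "'s topology"
  action_space :: "nat \<Rightarrow> 'a tvs"
  actions :: "nat \<Rightarrow> 'a set"
  policies :: "nat \<Rightarrow> ('s \<Rightarrow> 'a) set"
  value_fun :: "nat \<Rightarrow> 's \<Rightarrow> (nat \<Rightarrow> 's \<Rightarrow> 'a) \<Rightarrow> real"

definition players :: "('s, 'a) game \<Rightarrow> nat set" where
  "players G = {1..num_players G}"

definition is_game :: "('s, 'a) game \<Rightarrow> bool" where
  "is_game G \<longleftrightarrow>
     (\<forall>i\<in>players G.
        topological_vector_space (action_space G i) \<and>
        actions G i \<in> sets (borel_of (vtopology (action_space G i))) \<and>
        policies G i \<subseteq>
          borel_functions (state_space G) (vtopology (action_space G i)) (actions G i))"

definition other_profiles :: "('s, 'a) game \<Rightarrow> nat \<Rightarrow> (nat \<Rightarrow> 's \<Rightarrow> 'a) set" where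
  "other_profiles G i = (\<Pi>\<^sub>E j\<in>players G - {i}. policies G j)"

text \<open>
  For \<open>\<phi> \<in> other_profiles G i\<close> and \<open>p \<in> policies G i\<close>, the joint profile whose \<open>i\<close>-th component
  is \<open>p\<close> and whose other components are those of \<open>\<phi>\<close> is \<open>\<phi>(i := p)\<close>.
\<close>

definition closed_loop_potential ::
    "('s, 'a) game \<Rightarrow> 's \<Rightarrow> ((nat \<Rightarrow> 's \<Rightarrow> 'a) \<Rightarrow> real) \<Rightarrow> bool" where
  "closed_loop_potential G s\<^sub>0 \<Phi> \<longleftrightarrow>
     (\<forall>i\<in>players G. \<forall>p\<in>policies G i. \<forall>p'\<in>policies G i. \<forall>\<phi>\<in>other_profiles G i.
        \<Phi> (\<phi>(i := p')) - \<Phi> (\<phi>(i := p)) =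
        value_fun G i s\<^sub>0 (\<phi>(i := p')) - value_fun G i s\<^sub>0 (\<phi>(i := p)))"

definition markov_potential_game :: "('s, 'a) game \<Rightarrow> bool" where
  "markov_potential_game G \<longleftrightarrow>
     (\<exists>\<Phi> :: 's \<Rightarrow> (nat \<Rightarrow> 's \<Rightarrow> 'a) \<Rightarrow> real.
        \<forall>s\<^sub>0\<in>topspace (state_space G). closed_loop_potential G s\<^sub>0 (\<Phi> s\<^sub>0))"

end

theory Submission
  imports Defs
begin

text \<open>
  Player \<open>i\<close>'s share of the potential condition says that \<open>V\<^sub>i - \<Phi>\<close> is unchanged when player \<open>i\<close>
  switches policy, that is, that \<open>V\<^sub>i - \<Phi>\<close> is a function of the policies of the other players alone;
  this function is \<open>U\<^sub>i\<close>. The argument is pointwise in the profile of the others and is isolated in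
  \<open>equal_increments_iff_differ_by_function\<close>. For the Markov case the functions \<open>U\<^sub>i\<close>, obtained
  separately for each state and each player, are collected into one family by choice.
\<close>

text \<open>
  The difference \<open>g x - f x\<close> is constant on \<open>P\<close>, so its value at any element of \<open>P\<close> can serve
  as \<open>U x\<close>. If \<open>P\<close> is empty, both sides hold trivially.
\<close>

lemma equal_increments_iff_differ_by_function:
  fixes f g :: "'x \<Rightarrow> 'p \<Rightarrow> 'c::ab_group_add"
  shows "(\<forall>p\<in>P. \<forall>p'\<in>P. \<forall>x\<in>X. f x p' - f x p = g x p' - g x p) \<longleftrightarrow>
         (\<exists>U. \<forall>p\<in>P. \<forall>x\<in>X. g x p = f x p + U x)"
    (is "?increments \<longleftrightarrow> ?differ")
proof
  assume increments: ?increments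
  define q where "q = (SOME q. q \<in> P)"
  have "g x p = f x p + (g x q - f x q)" if "p \<in> P" "x \<in> X" for p x
  proof -
    have "q \<in> P"
      unfolding q_def using \<open>p \<in> P\<close> by (rule someI)
    then have "f x p - f x q = g x p - g x q"
      using increments that by blast
    then show ?thesis
      by (simp add: algebra_simps)
  qed
  then show ?differ
    by (intro exI[of _ "\<lambda>x. g x q - f x q"]) blast
next
  assume ?differ
  then show ?increments
    by auto
qed

lemma closed_loop_potential_iff:
  "closed_loop_potential G s \<Phi> \<longleftrightarrow>
     (\<forall>i\<in>players G. \<exists>U. \<forall>p\<in>policies G i. \<forall>\<phi>\<in>other_profiles G i.
        value_fun G i s (\<phi>(i := p)) = \<Phi> (\<phi>(i := p)) + U \<phi>)"
  unfolding closed_loop_potential_def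
  by (intro ball_cong refl equal_increments_iff_differ_by_function)

lemma markov_potential_game_iff:
  fixes G :: "('s, 'a) game"
  shows "markov_potential_game G \<longleftrightarrow>
    (\<exists>\<Phi> U. \<forall>s\<in>topspace (state_space G). \<forall>i\<in>players G.
       \<forall>p\<in>policies G i. \<forall>\<phi>\<in>other_profiles G i.
         value_fun G i s (\<phi>(i := p)) = \<Phi> s (\<phi>(i := p)) + U s i \<phi>)"
  unfolding markov_potential_game_def closed_loop_potential_iff bchoice_iff ..

theorem theorem2p2:
  fixes G :: "('s, 'a) game"
  assumes "is_game G"
  shows "(\<forall>s\<^sub>0\<in>topspace (state_space G). \<forall>\<Phi> :: (nat \<Rightarrow> 's \<Rightarrow> 'a) \<Rightarrow> real.
            closed_loop_potential G s\<^sub>0 \<Phi> \<longleftrightarrow>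
            (\<forall>i\<in>players G. \<exists>U :: (nat \<Rightarrow> 's \<Rightarrow> 'a) \<Rightarrow> real.
               \<forall>p\<in>policies G i. \<forall>\<phi>\<in>other_profiles G i.
                 value_fun G i s\<^sub>0 (\<phi>(i := p)) = \<Phi> (\<phi>(i := p)) + U \<phi>))
       \<and> (markov_potential_game G \<longleftrightarrow>
            (\<exists>(\<Phi> :: 's \<Rightarrow> (nat \<Rightarrow> 's \<Rightarrow> 'a) \<Rightarrow> real)
              (U :: 's \<Rightarrow> nat \<Rightarrow> (nat \<Rightarrow> 's \<Rightarrow> 'a) \<Rightarrow> real).
               \<forall>s\<^sub>0\<in>topspace (state_space G). \<forall>i\<in>players G.
                 \<forall>p\<in>policies G i. \<forall>\<phi>\<in>other_profiles G i.
                   value_fun G i s\<^sub>0 (\<phi>(i := p)) = \<Phi> s\<^sub>0 (\<phi>(i := p)) + U s\<^sub>0 i \<phi>))"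
  by (intro conjI ballI allI closed_loop_potential_iff markov_potential_game_iff)

end
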